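(* There is an absolute constant $c>0$ such that the following holds for every $n\in\mathbb{N}$, $n\ge 1$. Let $\varepsilon,\delta$ satisfy $0<\delta\le \varepsilon^2/200\le 1$ (with $\varepsilon>0$) and let $M:\mathbb{R}^n\to\mathbb{R}$ be an $(\varepsilon,\delta)$-differentially private (randomized) algorithm. Let $\beta\in[0,1/100]$ and $\alpha\ge 0$ be such that for every probability distribution $P$ on $\mathbb{R}$ with mean $\mu=\mathbb{E}_{X\leftarrow P}[X]\in[0,1]$ and $\mathbb{E}_{X\leftarrow P}[(X-\mu)^2]\le 1$ we have $$\left|\mathbb{E}_{X\leftarrow P^n,M}[M(X)-\mu]\right|\le\beta\qquad\text{and}\qquad \mathbb{E}_{X\leftarrow P^n,M}\left[(M(X)-\mu)^2\right]\le\alpha^2 .$$ Then $$\alpha^2\ \ge\ c\cdot\min\left\{\frac{1}{n^2\,\varepsilon^2\,\beta^2}\,,\ \frac{1}{n^2\,\varepsilon\,\delta^{1/2}}\right\}.$$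
   Context: A randomized algorithm $M:\mathcal{X}^n\to\mathcal{Y}$ is $(\varepsilon,\delta)$-differentially private ($(\varepsilon,\delta)$-DP), for $\varepsilon,\delta\ge0$, if for all datasets $x,x'\in\mathcal{X}^n$ differing in exactly one coordinate and all measurable $Y\subseteq\mathcal{Y}$, $\Pr[M(x)\in Y]\le e^{\varepsilon}\Pr[M(x')\in Y]+\delta$. $X\leftarrow P^n$ means $X=(X_1,\dots,X_n)$ consists of $n$ i.i.d. samples from $P$; $\mathbb{E}_{X\leftarrow P^n,M}$ is the expectation over both $X$ and the independent internal randomness of $M$. If $\beta=0$, the term $1/(n^2\varepsilon^2\beta^2)$ is read as $+\infty$. *)

theory Defs
  imports "HOL-Probability.Probability"
begin

text \<open>
  A dataset in \<open>X\<^sup>n\<close> is an extensional function on \<open>{..<n}\<close>, that is, a point of the product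
  measurable space. This allows the dimension \<open>n\<close> to be quantified inside a formula.
\<close>

definition dataset_space :: "nat \<Rightarrow> 'a measure \<Rightarrow> (nat \<Rightarrow> 'a) measure" where
  "dataset_space n X = PiM {..<n} (\<lambda>_. X)"

text \<open>
  A randomized algorithm is represented by its output laws: \<open>M x\<close> is the distribution of the
  output on input \<open>x\<close>. Measurability into the Giry space says that \<open>M\<close> is a Markov kernel.
\<close>

definition randomized_algorithm ::
    "nat \<Rightarrow> 'a measure \<Rightarrow> 'b measure \<Rightarrow> ((nat \<Rightarrow> 'a) \<Rightarrow> 'b measure) \<Rightarrow> bool" where
  "randomized_algorithm n X Y M \<longleftrightarrow> M \<in> dataset_space n X \<rightarrow>\<^sub>M prob_algebra Y"

definition neighbouring :: "nat \<Rightarrow> (nat \<Rightarrow> 'a) \<Rightarrow> (nat \<Rightarrow> 'a) \<Rightarrow> bool" where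
  "neighbouring n x x' \<longleftrightarrow> card {i \<in> {..<n}. x i \<noteq> x' i} = 1"

definition differentially_private ::
    "real \<Rightarrow> real \<Rightarrow> nat \<Rightarrow> 'a measure \<Rightarrow> 'b measure \<Rightarrow> ((nat \<Rightarrow> 'a) \<Rightarrow> 'b measure) \<Rightarrow> bool" where
  "differentially_private \<epsilon> \<delta> n X Y M \<longleftrightarrow>
     randomized_algorithm n X Y M \<and>
     (\<forall>x \<in> space (dataset_space n X). \<forall>x' \<in> space (dataset_space n X). neighbouring n x x' \<longrightarrow>
        (\<forall>S \<in> sets Y. measure (M x) S \<le> exp \<epsilon> * measure (M x') S + \<delta>))"

text \<open>
  The law of \<open>M(X)\<close> when \<open>X\<close> consists of \<open>n\<close> i.i.d. samples from \<open>P\<close> and the internal randomness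
  of \<open>M\<close> is independent of \<open>X\<close>.
\<close>

definition output_law :: "nat \<Rightarrow> 'a measure \<Rightarrow> ((nat \<Rightarrow> 'a) \<Rightarrow> 'b measure) \<Rightarrow> 'b measure" where
  "output_law n P M = PiM {..<n} (\<lambda>_. P) \<bind> M"

definition mean :: "real measure \<Rightarrow> real" where
  "mean P = (\<integral>x. x \<partial>P)"

text \<open>
  Second moments are nonnegative integrals, hence \<open>\<infinity>\<close> rather than \<open>0\<close> when they diverge.
\<close>

definition mean_square_deviation :: "real measure \<Rightarrow> real \<Rightarrow> ennreal" where
  "mean_square_deviation Q \<mu> = (\<integral>\<^sup>+ y. ennreal ((y - \<mu>)\<^sup>2) \<partial>Q)"

definition admissible :: "real measure \<Rightarrow> bool" where
  "admissible P \<longleftrightarrow>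
     prob_space P \<and> sets P = sets borel \<and>
     integrable P (\<lambda>x. x) \<and> mean P \<in> {0..1} \<and> mean_square_deviation P (mean P) \<le> 1"

end

theory Submission
  imports Defs
begin

text \<open>
  The hard instances are the two-point laws \<open>P\<^sub>p\<close> that put mass \<open>p\<close> at a large value \<open>v\<close> and mass
  \<open>1 - p\<close> at \<open>0\<close>. Their mean is \<open>p v\<close>, and they are admissible for \<open>0 \<le> p \<le> 1 / v\<^sup>2\<close> when
  \<open>v \<ge> 1\<close>. Let \<open>g p\<close> be
  the expected output of \<open>M\<close> on \<open>n\<close> samples from \<open>P\<^sub>p\<close>. Low bias forces \<open>g\<close> to climb from about \<open>0\<close>
  to about \<open>1 / v\<close> over this range of \<open>p\<close>, as long as \<open>\<beta>\<close> is at most \<open>1 / (4 v)\<close>: a rare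
  observation must move the output by order \<open>v / n\<close>. Privacy and low variance forbid that.

  Indeed \<open>g\<close> is a polynomial in \<open>p\<close>, and its derivative is the sum over the \<open>n\<close> coordinates of the
  expected effect of changing that coordinate from \<open>0\<close> to \<open>v\<close>
  (\<open>has_derivative_random_subset_mean\<close>). The two datasets are neighbours, so by
  \<open>expectation_shift_le_of_private\<close> the effect is at most a constant times
  \<open>(exp \<epsilon> - 1) E\<bar>Z'\<bar> + \<delta> T + (E Z\<^sup>2 + E Z'\<^sup>2) / T\<close> for every truncation level \<open>T\<close>, where \<open>Z\<close> and
  \<open>Z'\<close> are the estimation errors with and without the spike. A coordinate is \<open>0\<close> with probability
  at least \<open>1/2\<close>, so \<open>E Z'\<^sup>2 \<le> 2 \<alpha>\<^sup>2\<close> on average; it is \<open>v\<close> only with probability \<open>p\<close>, so all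
  that is known is \<open>E Z\<^sup>2 \<le> \<alpha>\<^sup>2 / p\<close>. The best \<open>T\<close> is \<open>\<alpha> / sqrt (\<delta> p)\<close>, and the slope of
  \<open>g\<close> is at most of order \<open>n \<alpha> ((exp \<epsilon> - 1) + sqrt (\<delta> / p))\<close> (\<open>expected_influence_le\<close>).

  The singularity at \<open>p = 0\<close> is integrable and disappears under the substitution \<open>p = s\<^sup>2\<close>: the mean
  value theorem for \<open>s \<mapsto> g (s\<^sup>2)\<close> on \<open>[0, 1 / v]\<close> gives
  \<open>1/2 \<le> n \<alpha> (3 (exp \<epsilon> - 1) / v + 8 sqrt \<delta>)\<close> (\<open>accurate_private_tradeoff\<close>). For
  \<open>v \<le> \<epsilon> / sqrt \<delta>\<close> the first summand dominates and \<open>\<alpha>\<close> is at least of order \<open>v / (n \<epsilon>)\<close>.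
  The theorem follows by taking for \<open>v\<close> the smaller of \<open>1 / (4 \<beta>)\<close> and \<open>\<epsilon> / sqrt \<delta>\<close>. The second
  choice yields \<open>1 / (n\<^sup>2 \<delta>)\<close>, which exceeds \<open>1 / (n\<^sup>2 \<epsilon> sqrt \<delta>)\<close> because \<open>sqrt \<delta> \<le> \<epsilon>\<close>.
\<close>

section \<open>Expectations under indistinguishable laws\<close>

text \<open>
  The layer-cake formula writes both expectations as integrals of \<open>measure Q {y. t < h y}\<close> over
  \<open>0 \<le> t \<le> T\<close>. The privacy inequality holds for each level set, and its additive term is
  paid once per unit of \<open>t\<close>, whence \<open>\<delta> * T\<close>.
\<close>

lemma bounded_expectation_le_of_private:
  fixes h :: "'b \<Rightarrow> real"
  assumes "prob_space Q" "prob_space Q'" "sets Q = sets Q'"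
    and dp: "\<And>S. S \<in> sets Q \<Longrightarrow> measure Q S \<le> exp \<epsilon> * measure Q' S + \<delta>"
    and h [measurable]: "h \<in> borel_measurable Q"
    and bounds: "\<And>y. 0 \<le> h y" "\<And>y. h y \<le> T"
    and nonneg: "0 \<le> \<delta>" "0 \<le> T"
  shows "(\<integral>y. h y \<partial>Q) \<le> exp \<epsilon> * (\<integral>y. h y \<partial>Q') + \<delta> * T"
proof -
  interpret Q: prob_space Q by fact
  interpret Q': prob_space Q' by fact
  have h' [measurable]: "h \<in> borel_measurable Q'"
    using h measurable_cong_sets[OF assms(3) refl] by blast
  have layer_cake: "ennreal (\<integral>y. h y \<partial>R) = (\<integral>\<^sup>+t. ennreal (measure R {y \<in> space R. 0 \<le> t \<and> t < h y}) \<partial>lborel)"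
    if "prob_space R" and [measurable]: "h \<in> borel_measurable R" for R
  proof -
    interpret R: prob_space R by fact
    interpret pair_sigma_finite R lborel ..
    have "integrable R h"
      by (rule R.integrable_const_bound[of _ T]) (use bounds in auto)
    then have "ennreal (\<integral>y. h y \<partial>R) = (\<integral>\<^sup>+y. ennreal (h y) \<partial>R)"
      by (subst nn_integral_eq_integral) (use bounds in auto)
    also have "\<dots> = (\<integral>\<^sup>+y. (\<integral>\<^sup>+t. indicator {z \<in> space (R \<Otimes>\<^sub>M lborel). 0 \<le> snd z \<and> snd z < h (fst z)} (y, t) \<partial>lborel) \<partial>R)"
    proof (intro nn_integral_cong)
      fix y assume "y \<in> space R"
      then have "(\<integral>\<^sup>+t. indicator {z \<in> space (R \<Otimes>\<^sub>M lborel). 0 \<le> snd z \<and> snd z < h (fst z)} (y, t) \<partial>lborel)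
          = (\<integral>\<^sup>+t. indicator {0..<h y} t \<partial>lborel)"
        by (intro nn_integral_cong) (auto simp: indicator_def space_pair_measure)
      also have "\<dots> = ennreal (h y)" using bounds(1)[of y] by simp
      finally show "ennreal (h y) = (\<integral>\<^sup>+t. indicator {z \<in> space (R \<Otimes>\<^sub>M lborel). 0 \<le> snd z \<and> snd z < h (fst z)} (y, t) \<partial>lborel)"
        by simp
    qed
    also have "\<dots> = (\<integral>\<^sup>+t. (\<integral>\<^sup>+y. indicator {z \<in> space (R \<Otimes>\<^sub>M lborel). 0 \<le> snd z \<and> snd z < h (fst z)} (y, t) \<partial>R) \<partial>lborel)"
      by (rule Fubini'[symmetric]) measurable
    also have "\<dots> = (\<integral>\<^sup>+t. ennreal (measure R {y \<in> space R. 0 \<le> t \<and> t < h y}) \<partial>lborel)"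
    proof (intro nn_integral_cong)
      fix t :: real
      have "(\<integral>\<^sup>+y. indicator {z \<in> space (R \<Otimes>\<^sub>M lborel). 0 \<le> snd z \<and> snd z < h (fst z)} (y, t) \<partial>R)
          = (\<integral>\<^sup>+y. indicator {y \<in> space R. 0 \<le> t \<and> t < h y} y \<partial>R)"
        by (intro nn_integral_cong) (auto simp: indicator_def space_pair_measure)
      also have "\<dots> = ennreal (measure R {y \<in> space R. 0 \<le> t \<and> t < h y})"
        by (simp add: R.emeasure_eq_measure)
      finally show "(\<integral>\<^sup>+y. indicator {z \<in> space (R \<Otimes>\<^sub>M lborel). 0 \<le> snd z \<and> snd z < h (fst z)} (y, t) \<partial>R)
         = ennreal (measure R {y \<in> space R. 0 \<le> t \<and> t < h y})" .
    qed
    finally show ?thesis .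
  qed
  let ?tail = "\<lambda>R t. measure R {y \<in> space R. 0 \<le> t \<and> t < h y}"
  have spaces: "space Q = space Q'"
    using assms(3) by (rule sets_eq_imp_space_eq)
  have [measurable]: "(\<lambda>t. ennreal (?tail Q' t)) \<in> borel_measurable lborel"
  proof -
    have "(\<lambda>t. emeasure Q' (Pair t -` {z \<in> space (lborel \<Otimes>\<^sub>M Q'). 0 \<le> fst z \<and> fst z < h (snd z)})) \<in> borel_measurable lborel"
      by (rule Q'.measurable_emeasure_Pair) measurable
    moreover have "Pair t -` {z \<in> space (lborel \<Otimes>\<^sub>M Q'). 0 \<le> fst z \<and> fst z < h (snd z)}
        = {y \<in> space Q'. 0 \<le> t \<and> t < h y}" for t
      by (auto simp: space_pair_measure)
    ultimately show ?thesis by (simp add: Q'.emeasure_eq_measure)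
  qed
  have "ennreal (\<integral>y. h y \<partial>Q) = (\<integral>\<^sup>+t. ennreal (?tail Q t) \<partial>lborel)"
    by (rule layer_cake) (use assms in auto)
  also have "\<dots> \<le> (\<integral>\<^sup>+t. ennreal (exp \<epsilon>) * ennreal (?tail Q' t) + ennreal \<delta> * indicator {0..T} t \<partial>lborel)"
  proof (intro nn_integral_mono)
    fix t :: real
    show "ennreal (?tail Q t) \<le> ennreal (exp \<epsilon>) * ennreal (?tail Q' t) + ennreal \<delta> * indicator {0..T} t"
    proof (cases "0 \<le> t \<and> t \<le> T")
      case True
      have "{y \<in> space Q. 0 \<le> t \<and> t < h y} \<in> sets Q" by measurable
      from dp[OF this] have "?tail Q t \<le> exp \<epsilon> * ?tail Q' t + \<delta>"
        by (simp add: spaces)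
      then show ?thesis
        using True nonneg by (simp flip: ennreal_mult ennreal_plus add: ennreal_leI)
    next
      case False
      have "t < h y \<Longrightarrow> t < T" for y using bounds(2)[of y] by linarith
      then have "{y \<in> space Q. 0 \<le> t \<and> t < h y} = {}" using False by force
      then show ?thesis by (simp only: measure_empty ennreal_0 zero_le)
    qed
  qed
  also have "\<dots> = ennreal (exp \<epsilon>) * (\<integral>\<^sup>+t. ennreal (?tail Q' t) \<partial>lborel) + ennreal \<delta> * ennreal T"
    using nonneg by (subst nn_integral_add) (auto simp: nn_integral_cmult)
  also have "(\<integral>\<^sup>+t. ennreal (?tail Q' t) \<partial>lborel) = ennreal (\<integral>y. h y \<partial>Q')"
    by (rule layer_cake[symmetric]) (use assms in auto)
  also have "ennreal (exp \<epsilon>) * ennreal (\<integral>y. h y \<partial>Q') + ennreal \<delta> * ennreal T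
      = ennreal (exp \<epsilon> * (\<integral>y. h y \<partial>Q') + \<delta> * T)"
    using nonneg bounds by (simp add: ennreal_mult ennreal_plus)
  finally show ?thesis
    using nonneg bounds by (subst (asm) ennreal_le_iff) auto
qed

text \<open>
  For an unbounded variable the additive \<open>\<delta>\<close> is harmless only below a truncation level \<open>T\<close>.
  Above it, the excess of \<open>\<bar>Z\<bar>\<close> is controlled by \<open>Z\<^sup>2 / T\<close>. The truncated positive part uses the
  privacy inequality from \<open>Q\<close> to \<open>Q'\<close>, the truncated negative part the reverse one, so that only the
  first moment under \<open>Q'\<close> is multiplied by \<open>exp \<epsilon> - 1\<close>. This asymmetry is essential: the law with
  the spike will be the one whose moments are poorly controlled.
\<close>

lemma expectation_shift_le_of_private:
  fixes Z :: "'b \<Rightarrow> real"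
  assumes "prob_space Q" "prob_space Q'" "sets Q = sets Q'"
    and dp: "\<And>S. S \<in> sets Q \<Longrightarrow> measure Q S \<le> exp \<epsilon> * measure Q' S + \<delta>"
                 "\<And>S. S \<in> sets Q \<Longrightarrow> measure Q' S \<le> exp \<epsilon> * measure Q S + \<delta>"
    and Z [measurable]: "Z \<in> borel_measurable Q"
    and sq: "integrable Q (\<lambda>y. (Z y)\<^sup>2)" "integrable Q' (\<lambda>y. (Z y)\<^sup>2)"
    and pos: "0 \<le> \<epsilon>" "0 \<le> \<delta>" "0 < T"
  shows "(\<integral>y. Z y \<partial>Q) - (\<integral>y. Z y \<partial>Q')
     \<le> (exp \<epsilon> - 1) * (\<integral>y. \<bar>Z y\<bar> \<partial>Q') + 2 * \<delta> * T
       + ((\<integral>y. (Z y)\<^sup>2 \<partial>Q) + (\<integral>y. (Z y)\<^sup>2 \<partial>Q')) / T"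
proof -
  interpret Q: prob_space Q by fact
  interpret Q': prob_space Q' by fact
  have Z' [measurable]: "Z \<in> borel_measurable Q'"
    using Z measurable_cong_sets[OF assms(3) refl] by blast
  define U where "U y = max 0 (min T (Z y))" for y
  define L where "L y = max 0 (min T (- Z y))" for y
  have [measurable]: "U \<in> borel_measurable Q" "L \<in> borel_measurable Q"
      "U \<in> borel_measurable Q'" "L \<in> borel_measurable Q'"
    unfolding U_def L_def by measurable
  have UL: "0 \<le> U y" "U y \<le> T" "0 \<le> L y" "L y \<le> T" for y
    using pos by (auto simp: U_def L_def)
  have trunc: "\<bar>Z y - (U y - L y)\<bar> \<le> (Z y)\<^sup>2 / T" for y
  proof -
    have "\<bar>Z y - (U y - L y)\<bar> * T \<le> (Z y)\<^sup>2"
    proof (cases "\<bar>Z y\<bar> \<le> T")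
      case True
      then have "Z y - (U y - L y) = 0" unfolding U_def L_def by auto
      then show ?thesis by simp
    next
      case False
      then have "\<bar>Z y - (U y - L y)\<bar> \<le> \<bar>Z y\<bar>" "T \<le> \<bar>Z y\<bar>"
        unfolding U_def L_def using pos by auto
      then have "\<bar>Z y - (U y - L y)\<bar> * T \<le> \<bar>Z y\<bar> * \<bar>Z y\<bar>"
        using pos by (intro mult_mono) auto
      then show ?thesis by (simp add: power2_eq_square)
    qed
    then show ?thesis using pos by (simp add: field_simps)
  qed
  have int: "integrable Q U" "integrable Q L" "integrable Q' U" "integrable Q' L"
    by (rule Q.integrable_const_bound[of _ T] Q'.integrable_const_bound[of _ T]; use UL in auto)+
  have intZ: "integrable Q Z" "integrable Q' Z"
    using sq by (auto intro: Q.square_integrable_imp_integrable Q'.square_integrable_imp_integrable)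
  have excess: "\<bar>(\<integral>y. Z y \<partial>R) - ((\<integral>y. U y \<partial>R) - (\<integral>y. L y \<partial>R))\<bar> \<le> (\<integral>y. (Z y)\<^sup>2 \<partial>R) / T"
    if "integrable R Z" "integrable R U" "integrable R L" "integrable R (\<lambda>y. (Z y)\<^sup>2)" for R
  proof -
    have "(\<integral>y. Z y \<partial>R) - ((\<integral>y. U y \<partial>R) - (\<integral>y. L y \<partial>R)) = (\<integral>y. Z y - (U y - L y) \<partial>R)"
      using that by simp
    also have "\<bar>\<dots>\<bar> \<le> (\<integral>y. \<bar>Z y - (U y - L y)\<bar> \<partial>R)"
      by (rule integral_abs_bound)
    also have "\<dots> \<le> (\<integral>y. (Z y)\<^sup>2 / T \<partial>R)"
      using that trunc by (intro integral_mono) auto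
    finally show ?thesis by simp
  qed
  have exp_eps: "1 \<le> exp \<epsilon>" using pos by simp
  have U_le: "(\<integral>y. U y \<partial>Q) \<le> exp \<epsilon> * (\<integral>y. U y \<partial>Q') + \<delta> * T"
    by (rule bounded_expectation_le_of_private) (use assms UL in auto)
  have "(\<integral>y. L y \<partial>Q') \<le> exp \<epsilon> * (\<integral>y. L y \<partial>Q) + \<delta> * T"
    by (rule bounded_expectation_le_of_private) (use assms UL in auto)
  moreover have L_nonneg: "0 \<le> (\<integral>y. L y \<partial>Q')" "0 \<le> (\<integral>y. L y \<partial>Q)" using UL by auto
  ultimately have L_ge: "(\<integral>y. L y \<partial>Q') - (\<integral>y. L y \<partial>Q) \<le> (exp \<epsilon> - 1) * (\<integral>y. L y \<partial>Q') + \<delta> * T"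
  proof (cases "(\<integral>y. L y \<partial>Q) \<le> (\<integral>y. L y \<partial>Q')")
    case True
    then have "(exp \<epsilon> - 1) * (\<integral>y. L y \<partial>Q) \<le> (exp \<epsilon> - 1) * (\<integral>y. L y \<partial>Q')"
      using exp_eps by (intro mult_left_mono) auto
    then show ?thesis using \<open>(\<integral>y. L y \<partial>Q') \<le> exp \<epsilon> * (\<integral>y. L y \<partial>Q) + \<delta> * T\<close>
      by (simp add: algebra_simps)
  next
    case False
    have "0 \<le> (exp \<epsilon> - 1) * (\<integral>y. L y \<partial>Q') + \<delta> * T"
      using exp_eps pos L_nonneg by auto
    then show ?thesis using False by linarith
  qed
  have "(\<integral>y. U y \<partial>Q') + (\<integral>y. L y \<partial>Q') = (\<integral>y. U y + L y \<partial>Q')"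
    using int by simp
  also have "\<dots> \<le> (\<integral>y. \<bar>Z y\<bar> \<partial>Q')"
    using int intZ by (intro integral_mono) (auto simp: U_def L_def)
  finally have "(exp \<epsilon> - 1) * ((\<integral>y. U y \<partial>Q') + (\<integral>y. L y \<partial>Q')) \<le> (exp \<epsilon> - 1) * (\<integral>y. \<bar>Z y\<bar> \<partial>Q')"
    using exp_eps by (intro mult_left_mono) auto
  moreover have "(\<integral>y. Z y \<partial>Q) - (\<integral>y. Z y \<partial>Q')
      \<le> ((\<integral>y. U y \<partial>Q) - (\<integral>y. U y \<partial>Q')) + ((\<integral>y. L y \<partial>Q') - (\<integral>y. L y \<partial>Q))
        + ((\<integral>y. (Z y)\<^sup>2 \<partial>Q) + (\<integral>y. (Z y)\<^sup>2 \<partial>Q')) / T"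
    using excess[OF intZ(1) int(1,2) sq(1)] excess[OF intZ(2) int(3,4) sq(2)]
    unfolding add_divide_distrib by linarith
  ultimately show ?thesis
    using U_le L_ge by (simp add: algebra_simps)
qed

section \<open>Random subsets and the derivative of their means\<close>

text \<open>
  The expectation of \<open>F\<close> at a random subset of \<open>I\<close> that contains each element independently with
  probability \<open>p\<close>, for finite \<open>I\<close>. The formula is a polynomial in \<open>p\<close>, and so can be differentiated
  also at the boundary values \<open>0\<close> and \<open>1\<close>, where it stops being an expectation on one side.
\<close>

definition random_subset_mean :: "real \<Rightarrow> 'i set \<Rightarrow> ('i set \<Rightarrow> real) \<Rightarrow> real" where
  "random_subset_mean p I F = (\<Sum>A\<in>Pow I. (\<Prod>i\<in>I. if i \<in> A then p else 1 - p) * F A)"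

lemma sum_Pow_insert:
  assumes "finite I" "j \<notin> I"
  shows "(\<Sum>A\<in>Pow (insert j I). G A) = (\<Sum>A\<in>Pow I. G A) + (\<Sum>A\<in>Pow I. G (insert j A))"
proof -
  have "inj_on (insert j) (Pow I)" 
    using assms by (auto simp: inj_on_def)
  moreover have "Pow I \<inter> insert j ` Pow I = {}" using assms by auto
  ultimately show ?thesis
    using assms by (simp add: Pow_insert sum.union_disjoint sum.reindex)
qed

lemma subset_weight_insert:
  assumes "finite I" "j \<notin> I" "A \<subseteq> I"
  shows "(\<Prod>i\<in>insert j I. if i \<in> A then p else 1 - p) = (1 - p) * (\<Prod>i\<in>I. if i \<in> A then p else 1 - p :: real)"
    and "(\<Prod>i\<in>insert j I. if i \<in> insert j A then p else 1 - p) = p * (\<Prod>i\<in>I. if i \<in> A then p else 1 - p :: real)"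
proof -
  have "(\<Prod>i\<in>I. if i \<in> insert j A then p else 1 - p) = (\<Prod>i\<in>I. if i \<in> A then p else 1 - p :: real)"
    using assms by (intro prod.cong) auto
  then show "(\<Prod>i\<in>insert j I. if i \<in> insert j A then p else 1 - p) = p * (\<Prod>i\<in>I. if i \<in> A then p else 1 - p :: real)"
    using assms by (simp del: insert_iff) simp
  show "(\<Prod>i\<in>insert j I. if i \<in> A then p else 1 - p) = (1 - p) * (\<Prod>i\<in>I. if i \<in> A then p else 1 - p :: real)"
    using assms by auto
qed

text \<open>
  Conditioning on whether \<open>j\<close> is chosen. Both the induction for the derivative and the moment bounds
  under a fixed value of one coordinate come from this identity.
\<close>

lemma random_subset_mean_insert:
  assumes "finite I" "j \<notin> I"
  shows "random_subset_mean p (insert j I) F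
    = (1 - p) * random_subset_mean p I F + p * random_subset_mean p I (\<lambda>A. F (insert j A))"
proof -
  have "random_subset_mean p (insert j I) F =
     (\<Sum>A\<in>Pow I. (1 - p) * ((\<Prod>i\<in>I. if i \<in> A then p else 1 - p) * F A))
     + (\<Sum>A\<in>Pow I. p * ((\<Prod>i\<in>I. if i \<in> A then p else 1 - p) * F (insert j A)))"
    unfolding random_subset_mean_def sum_Pow_insert[OF assms]
    using subset_weight_insert[OF assms] by (intro arg_cong2[where f = "(+)"] sum.cong) auto
  then show ?thesis by (simp add: random_subset_mean_def sum_distrib_left)
qed

lemma random_subset_mean_linear:
  "random_subset_mean p I (\<lambda>A. F A + G A) = random_subset_mean p I F + random_subset_mean p I G"
  "random_subset_mean p I (\<lambda>A. F A - G A) = random_subset_mean p I F - random_subset_mean p I G"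
  "random_subset_mean p I (\<lambda>A. k * F A) = k * random_subset_mean p I F"
  by (simp_all add: random_subset_mean_def algebra_simps sum.distrib sum_subtractf sum_distrib_left)

lemma random_subset_mean_const:
  assumes "finite I" shows "random_subset_mean p I (\<lambda>_. k) = k"
  using assms
proof (induction I)
  case empty then show ?case by (simp add: random_subset_mean_def)
next
  case (insert j I) then show ?case by (simp add: random_subset_mean_insert algebra_simps)
qed

lemma random_subset_mean_mono:
  assumes "0 \<le> p" "p \<le> 1" "\<And>A. A \<subseteq> I \<Longrightarrow> F A \<le> G A"
  shows "random_subset_mean p I F \<le> random_subset_mean p I G"
  unfolding random_subset_mean_def using assms
  by (intro sum_mono mult_left_mono prod_nonneg) auto

lemma random_subset_mean_nonneg:
  assumes "0 \<le> p" "p \<le> 1" "\<And>A. A \<subseteq> I \<Longrightarrow> 0 \<le> F A"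
  shows "0 \<le> random_subset_mean p I F"
  unfolding random_subset_mean_def using assms
  by (intro sum_nonneg mult_nonneg_nonneg prod_nonneg) auto

text \<open>
  The Margulis--Russo formula: with a separate probability for each element the mean is affine in
  each of them, its slope in the \<open>i\<close>-th being the mean influence of \<open>i\<close>; the diagonal derivative adds
  up these partial derivatives.
\<close>

lemma has_derivative_random_subset_mean:
  assumes "finite I"
  shows "((\<lambda>p. random_subset_mean p I F) has_real_derivative
    (\<Sum>i\<in>I. random_subset_mean p (I - {i}) (\<lambda>A. F (insert i A) - F A))) (at p)"
  using assms
proof (induction I arbitrary: F)
  case empty
  then show ?case by (simp add: random_subset_mean_def)
next
  case (insert j I)
  let ?D = "\<lambda>F. (\<Sum>i\<in>I. random_subset_mean p (I - {i}) (\<lambda>A. F (insert i A) - F A))"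
  have "((\<lambda>p. (1 - p) * random_subset_mean p I F + p * random_subset_mean p I (\<lambda>A. F (insert j A)))
      has_real_derivative
        (random_subset_mean p I (\<lambda>A. F (insert j A)) - random_subset_mean p I F)
        + ((1 - p) * ?D F + p * ?D (\<lambda>A. F (insert j A)))) (at p)"
    by (rule derivative_eq_intros insert.IH refl | simp add: algebra_simps)+
  moreover have "(\<Sum>i\<in>I. random_subset_mean p (insert j I - {i}) (\<lambda>A. F (insert i A) - F A))
      = (1 - p) * ?D F + p * ?D (\<lambda>A. F (insert j A))"
    unfolding sum_distrib_left sum.distrib[symmetric]
  proof (intro sum.cong refl)
    fix i assume "i \<in> I"
    with insert.hyps have "insert j I - {i} = insert j (I - {i})" "finite (I - {i})" "j \<notin> I - {i}" by auto
    then show "random_subset_mean p (insert j I - {i}) (\<lambda>A. F (insert i A) - F A) =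
      (1 - p) * random_subset_mean p (I - {i}) (\<lambda>A. F (insert i A) - F A) +
         p * random_subset_mean p (I - {i}) (\<lambda>A. F (insert j (insert i A)) - F (insert j A))"
      by (simp add: random_subset_mean_insert insert_commute[of i j])
  qed
  ultimately show ?case
    using insert.hyps
    by (simp add: random_subset_mean_insert random_subset_mean_linear)
qed


section \<open>Algorithms on samples from a two-point law\<close>

definition spike_law :: "real \<Rightarrow> real \<Rightarrow> real measure" where
  "spike_law v p = distr (measure_pmf (bernoulli_pmf p)) borel (\<lambda>b. if b then v else 0)"

definition spike_data :: "real \<Rightarrow> nat set \<Rightarrow> nat set \<Rightarrow> nat \<Rightarrow> real" where
  "spike_data v I A = (\<lambda>i\<in>I. if i \<in> A then v else 0)"

lemma prob_space_spike_law: "prob_space (spike_law v p)"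
  unfolding spike_law_def by (rule measure_pmf.prob_space_distr) simp

lemma sets_spike_law [measurable_cong, simp]: "sets (spike_law v p) = sets borel"
  by (simp add: spike_law_def)

lemma space_spike_law [simp]: "space (spike_law v p) = UNIV"
  by (simp add: spike_law_def)

lemma nn_integral_spike_law:
  assumes "0 \<le> p" "p \<le> 1" and [measurable]: "f \<in> borel_measurable borel"
  shows "(\<integral>\<^sup>+x. f x \<partial>spike_law v p) = ennreal (1 - p) * f 0 + ennreal p * f v"
  using assms by (simp add: spike_law_def nn_integral_distr mult.commute add.commute)

lemma mean_spike_law:
  assumes "0 \<le> p" "p \<le> 1"
  shows "mean (spike_law v p) = p * v"
  using assms by (simp add: mean_def spike_law_def integral_distr)

text \<open>
  The variance is \<open>(1 - p) * p * v\<^sup>2\<close>, so \<open>p = 1 / v\<^sup>2\<close> is, up to a constant, the largest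
  spike probability that unit variance permits.
\<close>

lemma admissible_spike_law:
  assumes "0 \<le> p" "p \<le> 1" "0 \<le> v" "p * v \<le> 1" "p * v\<^sup>2 \<le> 1"
  shows "admissible (spike_law v p)"
proof -
  have "mean_square_deviation (spike_law v p) (p * v)
      = ennreal ((1 - p) * (p * v)\<^sup>2 + p * (v - p * v)\<^sup>2)"
    using assms by (simp add: mean_square_deviation_def nn_integral_spike_law flip: ennreal_mult ennreal_plus)
  also have "(1 - p) * (p * v)\<^sup>2 + p * (v - p * v)\<^sup>2 = (1 - p) * (p * v\<^sup>2)"
    by (simp add: power2_eq_square algebra_simps)
  also have "ennreal \<dots> \<le> ennreal 1"
    using assms mult_mono[of "1 - p" 1 "p * v\<^sup>2" 1] by (intro ennreal_leI) auto
  finally have "mean_square_deviation (spike_law v p) (p * v) \<le> 1" by simp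
  moreover have "integrable (spike_law v p) (\<lambda>x. x)"
    unfolding spike_law_def by (subst integrable_distr_eq) (auto intro!: integrable_measure_pmf_finite)
  ultimately show ?thesis
    using assms by (simp add: admissible_def mean_spike_law prob_space_spike_law)
qed

text \<open>
  A sample from the product law is determined by the random set \<open>A\<close> of coordinates that show the
  spike. This turns the integrals into finite sums whose dependence on \<open>p\<close> is explicit.
\<close>

lemma nn_integral_PiM_spike_law:
  assumes p: "0 \<le> p" "p \<le> 1" and "finite I"
    and "f \<in> borel_measurable (PiM I (\<lambda>_. borel))"
  shows "(\<integral>\<^sup>+x. f x \<partial>PiM I (\<lambda>_. spike_law v p))
     = (\<Sum>A\<in>Pow I. ennreal (\<Prod>i\<in>I. if i \<in> A then p else 1 - p) * f (spike_data v I A))"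
  using assms(3,4)
proof (induction I arbitrary: f)
  case empty
  then show ?case by (simp add: PiM_empty nn_integral_count_space_finite spike_data_def restrict_def)
next
  case (insert j I)
  interpret product_sigma_finite "\<lambda>_. spike_law v p"
    by (rule product_sigma_finite.intro) (intro prob_space_imp_sigma_finite prob_space_spike_law)
  have PiM_eq: "sets (PiM J (\<lambda>_. spike_law v p)) = sets (PiM J (\<lambda>_. borel))" for J :: "nat set"
    by (intro sets_PiM_cong) auto
  note [measurable] = insert.prems
  have f: "f \<in> borel_measurable (PiM (insert j I) (\<lambda>_. spike_law v p))"
    using insert.prems measurable_cong_sets[OF PiM_eq refl] by blast
  have upd [measurable]: "(\<lambda>y. f (x(j := y))) \<in> borel_measurable borel"
    if "x \<in> space (PiM I (\<lambda>_. borel))" for x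
  proof -
    have "(\<lambda>y. x(j := y)) \<in> borel \<rightarrow>\<^sub>M PiM (insert j I) (\<lambda>_. borel)"
      using measurable_fun_upd[where I = "insert j I" and J = I and f = "\<lambda>_. x" and h = "\<lambda>y. y" and i = j and N = borel and M = "\<lambda>_. borel"] that
      by auto
    then show ?thesis by (rule measurable_compose) (rule insert.prems)
  qed
  have fix_j: "(\<lambda>x. f (x(j := y))) \<in> borel_measurable (PiM I (\<lambda>_. borel))" for y
  proof -
    have "(\<lambda>x. x(j := y)) \<in> PiM I (\<lambda>_. borel) \<rightarrow>\<^sub>M PiM (insert j I) (\<lambda>_. borel)"
      by (rule measurable_fun_upd[where J = I]) auto
    then show ?thesis by (rule measurable_compose) (rule insert.prems)
  qed
  have fix_j': "(\<lambda>x. f (x(j := y))) \<in> borel_measurable (PiM I (\<lambda>_. spike_law v p))" for y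
    using fix_j measurable_cong_sets[OF PiM_eq refl] by blast
  have upd_data: "(spike_data v I A)(j := 0) = spike_data v (insert j I) A"
    "(spike_data v I A)(j := v) = spike_data v (insert j I) (insert j A)" if "A \<in> Pow I" for A
    using insert.hyps that by (auto simp: spike_data_def fun_eq_iff restrict_def)
  have "(\<integral>\<^sup>+x. f x \<partial>PiM (insert j I) (\<lambda>_. spike_law v p))
      = (\<integral>\<^sup>+x. (\<integral>\<^sup>+y. f (x(j := y)) \<partial>spike_law v p) \<partial>PiM I (\<lambda>_. spike_law v p))"
    using insert.hyps f by (rule product_nn_integral_insert)
  also have "\<dots> = (\<integral>\<^sup>+x. ennreal (1 - p) * f (x(j := 0)) + ennreal p * f (x(j := v)) \<partial>PiM I (\<lambda>_. spike_law v p))"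
    using p upd by (intro nn_integral_cong nn_integral_spike_law) (auto simp: space_PiM)
  also have "\<dots> = ennreal (1 - p) * (\<integral>\<^sup>+x. f (x(j := 0)) \<partial>PiM I (\<lambda>_. spike_law v p))
      + ennreal p * (\<integral>\<^sup>+x. f (x(j := v)) \<partial>PiM I (\<lambda>_. spike_law v p))"
    using fix_j' by (simp add: nn_integral_add nn_integral_cmult)
  also have "\<dots> = (\<Sum>A\<in>Pow (insert j I). ennreal (\<Prod>i\<in>insert j I. if i \<in> A then p else 1 - p) * f (spike_data v (insert j I) A))"
    unfolding insert.IH[OF fix_j] sum_Pow_insert[OF insert.hyps] sum_distrib_left
  proof (intro arg_cong2[where f = "(+)"] sum.cong refl)
    fix A assume A: "A \<in> Pow I"
    have w: "0 \<le> (\<Prod>i\<in>I. if i \<in> A then p else 1 - p)" using p by (intro prod_nonneg) auto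
    show "ennreal (1 - p) * (ennreal (\<Prod>i\<in>I. if i \<in> A then p else 1 - p) * f ((spike_data v I A)(j := 0)))
      = ennreal (\<Prod>i\<in>insert j I. if i \<in> A then p else 1 - p) * f (spike_data v (insert j I) A)"
      using A p w subset_weight_insert(1)[OF insert.hyps, of A p]
      by (simp only: upd_data Pow_iff) (simp add: ennreal_mult mult.assoc)
    show "ennreal p * (ennreal (\<Prod>i\<in>I. if i \<in> A then p else 1 - p) * f ((spike_data v I A)(j := v)))
      = ennreal (\<Prod>i\<in>insert j I. if i \<in> insert j A then p else 1 - p) * f (spike_data v (insert j I) (insert j A))"
      using A p w subset_weight_insert(2)[OF insert.hyps, of A p]
      by (simp only: upd_data Pow_iff) (simp add: ennreal_mult mult.assoc)
  qed
  finally show ?case .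
qed

lemma spike_data_in_space: "spike_data v {..<n} A \<in> space (dataset_space n borel)"
  by (auto simp: spike_data_def dataset_space_def space_PiM)

lemma randomized_algorithm_spike_data:
  assumes "randomized_algorithm n borel borel M"
  shows "prob_space (M (spike_data v {..<n} A))" "sets (M (spike_data v {..<n} A)) = sets borel"
  using measurable_space[OF assms[unfolded randomized_algorithm_def] spike_data_in_space]
  by (auto simp: space_prob_algebra)

lemma measurable_algorithm_spike_law:
  assumes "randomized_algorithm n borel borel M"
  shows "M \<in> PiM {..<n} (\<lambda>_. spike_law v p) \<rightarrow>\<^sub>M subprob_algebra borel"
proof -
  have "sets (PiM {..<n} (\<lambda>_. spike_law v p)) = sets (PiM {..<n} (\<lambda>_. borel))"
    by (intro sets_PiM_cong) auto
  moreover have "M \<in> PiM {..<n} (\<lambda>_. borel) \<rightarrow>\<^sub>M subprob_algebra borel"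
    using assms by (auto simp: randomized_algorithm_def dataset_space_def intro: measurable_prob_algebraD)
  ultimately show ?thesis using measurable_cong_sets by blast
qed

lemma sets_output_law_spike_law:
  assumes "randomized_algorithm n borel borel M"
  shows "sets (output_law n (spike_law v p) M) = sets borel"
  unfolding output_law_def
  by (rule sets_bind[OF sets_kernel[OF measurable_algorithm_spike_law[OF assms]]])
     (auto simp: space_PiM PiE_eq_empty_iff)

lemma nn_integral_output_law_spike_law:
  assumes p: "0 \<le> p" "p \<le> 1" and M: "randomized_algorithm n borel borel M"
    and f [measurable]: "f \<in> borel_measurable borel"
  shows "(\<integral>\<^sup>+y. f y \<partial>output_law n (spike_law v p) M)
       = (\<Sum>A\<in>Pow {..<n}. ennreal (\<Prod>i\<in>{..<n}. if i \<in> A then p else 1 - p)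
            * (\<integral>\<^sup>+y. f y \<partial>M (spike_data v {..<n} A)))"
proof -
  have "M \<in> PiM {..<n} (\<lambda>_. borel) \<rightarrow>\<^sub>M subprob_algebra borel"
    using M by (auto simp: randomized_algorithm_def dataset_space_def intro: measurable_prob_algebraD)
  then have meas: "(\<lambda>x. \<integral>\<^sup>+y. f y \<partial>M x) \<in> borel_measurable (PiM {..<n} (\<lambda>_. borel))"
    by (rule measurable_compose[OF _ nn_integral_measurable_subprob_algebra]) measurable
  have "(\<integral>\<^sup>+y. f y \<partial>output_law n (spike_law v p) M)
      = (\<integral>\<^sup>+x. \<integral>\<^sup>+y. f y \<partial>M x \<partial>PiM {..<n} (\<lambda>_. spike_law v p))"
    unfolding output_law_def by (rule nn_integral_bind[OF f measurable_algorithm_spike_law[OF M]])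
  also have "\<dots> = (\<Sum>A\<in>Pow {..<n}. ennreal (\<Prod>i\<in>{..<n}. if i \<in> A then p else 1 - p)
            * (\<integral>\<^sup>+y. f y \<partial>M (spike_data v {..<n} A)))"
    using p meas by (intro nn_integral_PiM_spike_law) auto
  finally show ?thesis .
qed

lemma integral_output_law_spike_law:
  fixes f :: "real \<Rightarrow> real"
  assumes p: "0 \<le> p" "p \<le> 1" and M: "randomized_algorithm n borel borel M"
    and int: "\<And>A. A \<subseteq> {..<n} \<Longrightarrow> integrable (M (spike_data v {..<n} A)) f"
    and f [measurable]: "f \<in> borel_measurable borel"
  shows "(\<integral>y. f y \<partial>output_law n (spike_law v p) M)
       = random_subset_mean p {..<n} (\<lambda>A. \<integral>y. f y \<partial>M (spike_data v {..<n} A))" (is ?eq)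
    and "integrable (output_law n (spike_law v p) M) f" (is ?int)
proof -
  let ?Out = "output_law n (spike_law v p) M"
  have borel_out: "g \<in> borel_measurable ?Out" if "g \<in> borel_measurable borel" for g :: "real \<Rightarrow> real"
    using that measurable_cong_sets[OF sets_output_law_spike_law[OF M] refl] by blast
  have nonneg: "integrable ?Out g \<and>
      (\<integral>y. g y \<partial>?Out) = random_subset_mean p {..<n} (\<lambda>A. \<integral>y. g y \<partial>M (spike_data v {..<n} A))"
    if g: "g \<in> borel_measurable borel" "\<And>y. 0 \<le> g y"
      and intg: "\<And>A. A \<subseteq> {..<n} \<Longrightarrow> integrable (M (spike_data v {..<n} A)) g" for g
  proof -
    have w: "0 \<le> (\<Prod>i\<in>{..<n}. if i \<in> A then p else 1 - p)" for A
      using p by (intro prod_nonneg) auto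
    have ig: "0 \<le> (\<integral>y. g y \<partial>M (spike_data v {..<n} A))" for A
      using g by (intro integral_nonneg_AE) auto
    have "(\<integral>\<^sup>+y. ennreal (g y) \<partial>?Out)
      = (\<Sum>A\<in>Pow {..<n}. ennreal (\<Prod>i\<in>{..<n}. if i \<in> A then p else 1 - p)
            * (\<integral>\<^sup>+y. ennreal (g y) \<partial>M (spike_data v {..<n} A)))"
      using g by (intro nn_integral_output_law_spike_law p M) measurable
    also have "\<dots> = (\<Sum>A\<in>Pow {..<n}. ennreal ((\<Prod>i\<in>{..<n}. if i \<in> A then p else 1 - p)
            * (\<integral>y. g y \<partial>M (spike_data v {..<n} A))))"
      using g intg w ig by (intro sum.cong refl) (auto simp: nn_integral_eq_integral ennreal_mult)
    also have "\<dots> = ennreal (random_subset_mean p {..<n} (\<lambda>A. \<integral>y. g y \<partial>M (spike_data v {..<n} A)))"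
      unfolding random_subset_mean_def using w ig by (intro sum_ennreal) auto
    finally have eq: "(\<integral>\<^sup>+y. ennreal (g y) \<partial>?Out)
        = ennreal (random_subset_mean p {..<n} (\<lambda>A. \<integral>y. g y \<partial>M (spike_data v {..<n} A)))" .
    have "0 \<le> random_subset_mean p {..<n} (\<lambda>A. \<integral>y. g y \<partial>M (spike_data v {..<n} A))"
      using p ig by (intro random_subset_mean_nonneg)
    then show ?thesis
      using integrableI_nn_integral_finite[OF borel_out[OF g(1)] _ eq]
        integral_eq_nn_integral[OF borel_out[OF g(1)]] eq g(2) by simp
  qed
  let ?pos = "\<lambda>y. max 0 (f y)" and ?neg = "\<lambda>y. max 0 (- f y)"
  have pos: "integrable ?Out ?pos \<and>
      (\<integral>y. ?pos y \<partial>?Out) = random_subset_mean p {..<n} (\<lambda>A. \<integral>y. ?pos y \<partial>M (spike_data v {..<n} A))"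
    using int by (intro nonneg) auto
  have neg: "integrable ?Out ?neg \<and>
      (\<integral>y. ?neg y \<partial>?Out) = random_subset_mean p {..<n} (\<lambda>A. \<integral>y. ?neg y \<partial>M (spike_data v {..<n} A))"
    using int by (intro nonneg) auto
  have split: "f = (\<lambda>y. ?pos y - ?neg y)" by (auto simp: fun_eq_iff max_def)
  have "integrable ?Out (\<lambda>y. ?pos y - ?neg y)" using pos neg by auto
  then show ?int using split by simp
  have "(\<integral>y. f y \<partial>?Out) = (\<integral>y. ?pos y - ?neg y \<partial>?Out)" using split by simp
  also have "\<dots> = random_subset_mean p {..<n} (\<lambda>A. (\<integral>y. ?pos y \<partial>M (spike_data v {..<n} A))
       - (\<integral>y. ?neg y \<partial>M (spike_data v {..<n} A)))"
    using pos neg by (simp add: random_subset_mean_linear)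
  also have "\<dots> = random_subset_mean p {..<n} (\<lambda>A. \<integral>y. f y \<partial>M (spike_data v {..<n} A))"
    unfolding random_subset_mean_def
  proof (intro sum.cong refl arg_cong2[where f = "(*)"])
    fix A assume "A \<in> Pow {..<n}"
    then have i: "integrable (M (spike_data v {..<n} A)) f" using int by auto
    have "(\<integral>y. f y \<partial>M (spike_data v {..<n} A)) = (\<integral>y. ?pos y - ?neg y \<partial>M (spike_data v {..<n} A))"
      using split by simp
    also have "\<dots> = (\<integral>y. ?pos y \<partial>M (spike_data v {..<n} A)) - (\<integral>y. ?neg y \<partial>M (spike_data v {..<n} A))"
      using i by (intro Bochner_Integration.integral_diff) auto
    finally show "(\<integral>y. ?pos y \<partial>M (spike_data v {..<n} A)) - (\<integral>y. ?neg y \<partial>M (spike_data v {..<n} A))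
      = (\<integral>y. f y \<partial>M (spike_data v {..<n} A))" by simp
  qed
  finally show ?eq .
qed


lemma neighbouring_spike_data:
  assumes "i < n" "i \<notin> A" "v \<noteq> 0"
  shows "neighbouring n (spike_data v {..<n} (insert i A)) (spike_data v {..<n} A)"
    and "neighbouring n (spike_data v {..<n} A) (spike_data v {..<n} (insert i A))"
proof -
  have "{j \<in> {..<n}. spike_data v {..<n} (insert i A) j \<noteq> spike_data v {..<n} A j} = {i}"
    "{j \<in> {..<n}. spike_data v {..<n} A j \<noteq> spike_data v {..<n} (insert i A) j} = {i}"
    using assms by (auto simp: spike_data_def)
  then show "neighbouring n (spike_data v {..<n} (insert i A)) (spike_data v {..<n} A)"
    "neighbouring n (spike_data v {..<n} A) (spike_data v {..<n} (insert i A))"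
    by (simp_all add: neighbouring_def)
qed

section \<open>Privacy against accuracy\<close>

text \<open>
  The truncated comparison is applied for each configuration \<open>A\<close> of the other coordinates and then
  averaged. For the average to involve second moments only linearly, \<open>E\<bar>Z\<bar>\<close> is bounded by
  \<open>\<alpha> / 2 + E Z\<^sup>2 / (2 \<alpha>)\<close> instead of \<open>sqrt (E Z\<^sup>2)\<close>, and the level \<open>T\<close> does not depend on \<open>A\<close>. Conditioning on
  coordinate \<open>i\<close> costs a factor \<open>1 / (1 - p) \<le> 2\<close> in the second moment when it is \<open>0\<close>, and a
  factor \<open>1 / p\<close> when it is \<open>v\<close>. The parametrisation \<open>p = s\<^sup>2\<close> replaces \<open>sqrt p\<close> by \<open>s\<close>.
\<close>

lemma expected_influence_le:
  assumes dp: "differentially_private \<epsilon> \<delta> n borel borel M"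
    and pos: "0 < \<epsilon>" "0 < \<delta>" "0 < \<alpha>" "0 < s" "s \<le> 1/2" and "v \<noteq> 0" "i < n"
    and int: "\<And>A. A \<subseteq> {..<n} \<Longrightarrow> integrable (M (spike_data v {..<n} A)) (\<lambda>y. (y - m)\<^sup>2)"
    and sq: "random_subset_mean (s\<^sup>2) {..<n} (\<lambda>A. \<integral>y. (y - m)\<^sup>2 \<partial>M (spike_data v {..<n} A)) \<le> \<alpha>\<^sup>2"
  shows "random_subset_mean (s\<^sup>2) ({..<n} - {i})
       (\<lambda>A. (\<integral>y. y \<partial>M (spike_data v {..<n} (insert i A))) - (\<integral>y. y \<partial>M (spike_data v {..<n} A)))
     \<le> \<alpha> * (3/2 * (exp \<epsilon> - 1) + 4 * sqrt \<delta> / s)"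
proof -
  let ?M = "\<lambda>A. M (spike_data v {..<n} A)" and ?J = "{..<n} - {i}" and ?p = "s\<^sup>2"
  define V where "V A = (\<integral>y. (y - m)\<^sup>2 \<partial>?M A)" for A
  \<comment> \<open>This level balances \<open>\<delta> * T\<close> against \<open>\<alpha>\<^sup>2 / (s\<^sup>2 * T)\<close>; both become \<open>\<alpha> * sqrt \<delta> / s\<close>.\<close>
  define T where "T = \<alpha> / (sqrt \<delta> * s)"
  have T: "0 < T" using pos by (simp add: T_def)
  have alg: "randomized_algorithm n borel borel M" using dp by (simp add: differentially_private_def)
  note M = randomized_algorithm_spike_data[OF alg, of v]
  have e: "0 \<le> exp \<epsilon> - 1" using pos by simp
  have intT: "integrable (?M A) (\<lambda>y. y - m)" "integrable (?M A) (\<lambda>y. y)" if "A \<subseteq> {..<n}" for A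
  proof -
    interpret prob_space "?M A" by (rule M)
    note [measurable_cong] = M(2)
    show 1: "integrable (?M A) (\<lambda>y. y - m)"
      by (rule square_integrable_imp_integrable[OF _ int[OF that]]) measurable
    show "integrable (?M A) (\<lambda>y. y)"
      using Bochner_Integration.integrable_add[OF 1 integrable_const[of m]] by simp
  qed
  have pointwise: "(\<integral>y. y \<partial>?M (insert i A)) - (\<integral>y. y \<partial>?M A)
     \<le> ((exp \<epsilon> - 1) * \<alpha> / 2 + 2 * \<delta> * T) + (((exp \<epsilon> - 1) / (2 * \<alpha>) + 1 / T) * V A + (1 / T) * V (insert i A))"
    if A: "A \<subseteq> ?J" for A
  proof -
    have A': "A \<subseteq> {..<n}" "insert i A \<subseteq> {..<n}" "i \<notin> A" using A \<open>i < n\<close> by auto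
    interpret Q: prob_space "?M (insert i A)" by (rule M)
    interpret Q': prob_space "?M A" by (rule M)
    have measZ: "(\<lambda>y. y - m) \<in> borel_measurable (?M (insert i A))"
      using intT(1)[OF A'(2)] by (rule borel_measurable_integrable)
    have dpA: "measure (?M (insert i A)) S \<le> exp \<epsilon> * measure (?M A) S + \<delta>"
      "measure (?M A) S \<le> exp \<epsilon> * measure (?M (insert i A)) S + \<delta>"
      if "S \<in> sets (?M (insert i A))" for S
      using dp that neighbouring_spike_data[OF \<open>i < n\<close> \<open>i \<notin> A\<close> \<open>v \<noteq> 0\<close>] spike_data_in_space M(2)
      unfolding differentially_private_def by blast+
    have "(\<integral>y. y \<partial>?M (insert i A)) - (\<integral>y. y \<partial>?M A) = (\<integral>y. y - m \<partial>?M (insert i A)) - (\<integral>y. y - m \<partial>?M A)"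
      using intT(2) A' by (simp add: Q.prob_space Q'.prob_space)
    also have "\<dots> \<le> (exp \<epsilon> - 1) * (\<integral>y. \<bar>y - m\<bar> \<partial>?M A) + 2 * \<delta> * T + (V (insert i A) + V A) / T"
      unfolding V_def
      by (rule expectation_shift_le_of_private[OF M(1) M(1) _ dpA measZ int int])
         (use A' pos T M(2) in auto)
    finally have shift: "(\<integral>y. y \<partial>?M (insert i A)) - (\<integral>y. y \<partial>?M A)
      \<le> (exp \<epsilon> - 1) * (\<integral>y. \<bar>y - m\<bar> \<partial>?M A) + 2 * \<delta> * T + (V (insert i A) + V A) / T" .
    have "(\<integral>y. \<bar>y - m\<bar> \<partial>?M A) \<le> (\<integral>y. \<alpha> / 2 + (y - m)\<^sup>2 / (2 * \<alpha>) \<partial>?M A)"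
    proof (rule integral_mono)
      fix y
      have "0 \<le> (\<bar>y - m\<bar> - \<alpha>)\<^sup>2" by simp
      then show "\<bar>y - m\<bar> \<le> \<alpha> / 2 + (y - m)\<^sup>2 / (2 * \<alpha>)"
        using pos by (simp add: power2_diff field_simps power2_eq_square)
    qed (use int intT A' in auto)
    also have "\<dots> = \<alpha> / 2 + V A / (2 * \<alpha>)"
      unfolding V_def using int[OF A'(1)] by (simp add: Q'.prob_space)
    finally have "(exp \<epsilon> - 1) * (\<integral>y. \<bar>y - m\<bar> \<partial>?M A) \<le> (exp \<epsilon> - 1) * (\<alpha> / 2 + V A / (2 * \<alpha>))"
      using e by (rule mult_left_mono)
    with shift show ?thesis by (simp add: algebra_simps add_divide_distrib diff_divide_distrib)
  qed
  have V: "0 \<le> V A" for A unfolding V_def by simp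
  have p: "0 < ?p" "?p \<le> 1/2"
    using pos power_mono[of s "1/2" 2] by (auto simp: power2_eq_square)
  have split: "(1 - ?p) * random_subset_mean ?p ?J V + ?p * random_subset_mean ?p ?J (\<lambda>A. V (insert i A)) \<le> \<alpha>\<^sup>2"
    using sq random_subset_mean_insert[of ?J i ?p V] \<open>i < n\<close> by (simp add: insert_absorb V_def[abs_def])
  have V0: "0 \<le> random_subset_mean ?p ?J V" "0 \<le> random_subset_mean ?p ?J (\<lambda>A. V (insert i A))"
    using p V by (auto intro!: random_subset_mean_nonneg)
  have "(1/2) * random_subset_mean ?p ?J V \<le> (1 - ?p) * random_subset_mean ?p ?J V"
    using p V0 by (intro mult_right_mono) auto
  moreover have "0 \<le> ?p * random_subset_mean ?p ?J (\<lambda>A. V (insert i A))"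
    using p V0 by auto
  ultimately have V1: "random_subset_mean ?p ?J V \<le> 2 * \<alpha>\<^sup>2" using split by linarith
  have "0 \<le> (1 - ?p) * random_subset_mean ?p ?J V" using p V0 by auto
  then have "?p * random_subset_mean ?p ?J (\<lambda>A. V (insert i A)) \<le> \<alpha>\<^sup>2" using split by linarith
  then have V2: "random_subset_mean ?p ?J (\<lambda>A. V (insert i A)) \<le> \<alpha>\<^sup>2 / ?p"
    using p by (simp add: field_simps)
  have "random_subset_mean ?p ?J (\<lambda>A. (\<integral>y. y \<partial>?M (insert i A)) - (\<integral>y. y \<partial>?M A))
    \<le> random_subset_mean ?p ?J (\<lambda>A. ((exp \<epsilon> - 1) * \<alpha> / 2 + 2 * \<delta> * T)
         + (((exp \<epsilon> - 1) / (2 * \<alpha>) + 1 / T) * V A + (1 / T) * V (insert i A)))"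
    using p pointwise by (intro random_subset_mean_mono) auto
  also have "\<dots> = ((exp \<epsilon> - 1) * \<alpha> / 2 + 2 * \<delta> * T)
      + (((exp \<epsilon> - 1) / (2 * \<alpha>) + 1 / T) * random_subset_mean ?p ?J V
         + (1 / T) * random_subset_mean ?p ?J (\<lambda>A. V (insert i A)))"
    by (simp only: random_subset_mean_linear(1,3) random_subset_mean_const finite_Diff finite_lessThan)
  also have "\<dots> \<le> ((exp \<epsilon> - 1) * \<alpha> / 2 + 2 * \<delta> * T)
      + (((exp \<epsilon> - 1) / (2 * \<alpha>) + 1 / T) * (2 * \<alpha>\<^sup>2) + (1 / T) * (\<alpha>\<^sup>2 / ?p))"
    using V1 V2 e T pos by (intro add_mono mult_left_mono order_refl) auto
  also have "((exp \<epsilon> - 1) / (2 * \<alpha>) + 1 / T) * (2 * \<alpha>\<^sup>2) = (exp \<epsilon> - 1) * \<alpha> + 2 * (\<alpha>\<^sup>2 / T)"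
    using pos by (simp add: distrib_right power2_eq_square)
  also have "(exp \<epsilon> - 1) * \<alpha> / 2 + 2 * \<delta> * T + ((exp \<epsilon> - 1) * \<alpha> + 2 * (\<alpha>\<^sup>2 / T) + (1 / T) * (\<alpha>\<^sup>2 / ?p))
      = 3/2 * (exp \<epsilon> - 1) * \<alpha> + 2 * \<delta> * T + (2 + 1 / ?p) * (\<alpha>\<^sup>2 / T)"
    by (simp add: algebra_simps diff_divide_distrib)
  also have "\<dots> \<le> 3/2 * (exp \<epsilon> - 1) * \<alpha> + 2 * \<delta> * T + (2 / ?p) * (\<alpha>\<^sup>2 / T)"
  proof -
    have "2 + 1 / ?p \<le> 2 / ?p" using p by (simp add: divide_simps)
    then show ?thesis using T by (intro add_left_mono mult_right_mono) auto
  qed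
  also have "2 * \<delta> * T = 2 * (\<alpha> * sqrt \<delta> / s)"
  proof -
    have "2 * (r * r) * (\<alpha> / (r * s)) = 2 * (\<alpha> * r / s)" if "r > 0" for r :: real
      using that pos by (simp add: divide_simps)
    from this[of "sqrt \<delta>"] show ?thesis using pos by (simp add: T_def)
  qed
  also have "(2 / ?p) * (\<alpha>\<^sup>2 / T) = 2 * (\<alpha> * sqrt \<delta> / s)"
  proof -
    have "(2 / ?p) * (\<alpha>\<^sup>2 / (\<alpha> / (r * s))) = 2 * (\<alpha> * r / s)" if "r > 0" for r :: real
      using that pos by (simp add: divide_simps power2_eq_square)
    from this[of "sqrt \<delta>"] show ?thesis using pos by (simp add: T_def)
  qed
  finally show ?thesis by (simp add: algebra_simps V_def)
qed


text \<open>
  For \<open>0 < p < 1\<close> every configuration \<open>A\<close> has positive probability, so finiteness of the averaged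
  second moment at a single such \<open>p\<close> makes the output square integrable on every dataset with values
  in \<open>{0, v}\<close>.
\<close>

lemma square_integrable_of_finite_second_moment:
  assumes M: "randomized_algorithm n borel borel M" and p: "0 < p" "p < 1"
    and fin: "mean_square_deviation (output_law n (spike_law v p) M) m < \<infinity>"
    and A: "A \<subseteq> {..<n}"
  shows "integrable (M (spike_data v {..<n} A)) (\<lambda>y. (y - k)\<^sup>2)"
proof -
  let ?Q = "M (spike_data v {..<n} A)"
  interpret prob_space ?Q by (rule randomized_algorithm_spike_data[OF M])
  note [measurable_cong] = randomized_algorithm_spike_data(2)[OF M, of v A]
  have eq: "mean_square_deviation (output_law n (spike_law v p) M) m =
     (\<Sum>A\<in>Pow {..<n}. ennreal (\<Prod>i\<in>{..<n}. if i \<in> A then p else 1 - p)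
            * (\<integral>\<^sup>+y. ennreal ((y - m)\<^sup>2) \<partial>M (spike_data v {..<n} A)))"
    unfolding mean_square_deviation_def
    using p by (intro nn_integral_output_law_spike_law M) auto
  have "ennreal (\<Prod>i\<in>{..<n}. if i \<in> A then p else 1 - p) * (\<integral>\<^sup>+y. ennreal ((y - m)\<^sup>2) \<partial>?Q) < \<infinity>"
    using A by (intro le_less_trans[OF member_le_sum fin[unfolded eq]]) auto
  moreover have "0 < (\<Prod>i\<in>{..<n}. if i \<in> A then p else 1 - p)"
    using p by (intro prod_pos) auto
  ultimately have "(\<integral>\<^sup>+y. ennreal ((y - m)\<^sup>2) \<partial>?Q) < \<infinity>"
    unfolding ennreal_mult_less_top infinity_ennreal_def by (simp only: ennreal_eq_0_iff) auto
  then have int: "integrable ?Q (\<lambda>y. (y - m)\<^sup>2)"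
    by (intro integrableI_nonneg) auto
  then have "integrable ?Q (\<lambda>y. y - m)"
    by (rule square_integrable_imp_integrable[rotated]) measurable
  with int have "integrable ?Q (\<lambda>y. (y - m)\<^sup>2 + 2 * (m - k) * (y - m) + (m - k)\<^sup>2)"
    by simp
  moreover have "(y - m)\<^sup>2 + 2 * (m - k) * (y - m) + (m - k)\<^sup>2 = (y - k)\<^sup>2" for y
    by (simp add: power2_eq_square algebra_simps)
  ultimately show ?thesis by simp
qed

text \<open>
  At \<open>s = 1 / v\<close> the target mean \<open>s\<^sup>2 * v\<close> is \<open>1 / v\<close>, and at \<open>s = 0\<close> it is \<open>0\<close>. The two biases
  together take away at most \<open>2 * \<beta> \<le> 1 / (2 * v)\<close>, so the mean output rises by at least half of
  \<open>1 / v\<close> over an interval of length \<open>1 / v\<close>. The factor \<open>2 * s\<close> from the chain rule cancels the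
  \<open>1 / s\<close> in the influence bound, which keeps the slope bounded down to \<open>s = 0\<close>.
\<close>

lemma accurate_private_tradeoff:
  assumes dp: "differentially_private \<epsilon> \<delta> n borel borel M"
    and pos: "0 < \<epsilon>" "0 < \<delta>" "0 < \<alpha>" "2 \<le> v" and bv: "4 * \<beta> * v \<le> 1"
    and accurate: "\<And>P. admissible P \<Longrightarrow>
          \<bar>\<integral>y. (y - mean P) \<partial>(output_law n P M)\<bar> \<le> \<beta> \<and>
          mean_square_deviation (output_law n P M) (mean P) \<le> ennreal (\<alpha>\<^sup>2)"
  shows "1/2 \<le> real n * \<alpha> * (3 * (exp \<epsilon> - 1) / v + 8 * sqrt \<delta>)"
proof -
  let ?I = "{..<n}" and ?M = "\<lambda>A. M (spike_data v {..<n} A)"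
  define F where "F A = (\<integral>y. y \<partial>?M A)" for A
  define D where "D p = (\<Sum>i\<in>?I. random_subset_mean p (?I - {i}) (\<lambda>A. F (insert i A) - F A))" for p
  have M: "randomized_algorithm n borel borel M" using dp by (simp add: differentially_private_def)
  have v: "0 < v" "1 / v \<le> 1/2" "v * (1 / v) = 1" using pos by (auto simp: field_simps)
  have adm: "admissible (spike_law v (s\<^sup>2))" "0 \<le> s\<^sup>2" "s\<^sup>2 \<le> 1" if "0 \<le> s" "s \<le> 1 / v" for s
  proof -
    have sv: "s * v \<le> 1" using that v by (simp add: field_simps)
    have "s \<le> 1 / 2" using that(2) v(2) by (rule order_trans)
    then have s: "s \<le> 1" by simp
    show "0 \<le> s\<^sup>2" by simp
    show s2: "s\<^sup>2 \<le> 1" using that s by (simp add: power_le_one)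
    have "s * (s * v) \<le> 1 * 1"
      by (rule mult_mono[OF s sv]) (use that(1) v(1) in simp_all)
    moreover have "(s * v)\<^sup>2 \<le> 1" using that sv v by (intro power_le_one) auto
    ultimately show "admissible (spike_law v (s\<^sup>2))"
      using that s2 v by (intro admissible_spike_law) (auto simp: power2_eq_square algebra_simps)
  qed
  have mean: "mean (spike_law v (s\<^sup>2)) = s\<^sup>2 * v" if "0 \<le> s" "s \<le> 1 / v" for s
    using adm(2,3)[OF that] by (rule mean_spike_law)
  have int: "integrable (?M A) (\<lambda>y. (y - k)\<^sup>2)" if "A \<subseteq> ?I" for A k
  proof (rule square_integrable_of_finite_second_moment[OF M _ _ _ that])
    have b: "0 \<le> 1 / v" "1 / v \<le> 1 / v" using v by auto
    show "0 < (1 / v)\<^sup>2" using v by simp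
    have "(1 / v)\<^sup>2 \<le> (1/2)\<^sup>2" using v by (intro power_mono) auto
    then show "(1 / v)\<^sup>2 < 1" by (simp add: power2_eq_square)
    show "mean_square_deviation (output_law n (spike_law v ((1 / v)\<^sup>2)) M) (mean (spike_law v ((1 / v)\<^sup>2))) < \<infinity>"
      using accurate[OF adm(1)[OF b]] by (auto intro: le_less_trans simp: ennreal_less_top)
  qed
  have int1: "integrable (?M A) (\<lambda>y. y)" if "A \<subseteq> ?I" for A
  proof -
    interpret prob_space "?M A" by (rule randomized_algorithm_spike_data[OF M])
    note [measurable_cong] = randomized_algorithm_spike_data(2)[OF M, of v A]
    show ?thesis
      by (rule square_integrable_imp_integrable) (use int[OF that, of 0] in auto)
  qed
  have bias: "\<bar>random_subset_mean (s\<^sup>2) ?I F - s\<^sup>2 * v\<bar> \<le> \<beta>" if s: "0 \<le> s" "s \<le> 1 / v" for s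
  proof -
    have "(\<integral>y. y - s\<^sup>2 * v \<partial>output_law n (spike_law v (s\<^sup>2)) M)
        = random_subset_mean (s\<^sup>2) ?I (\<lambda>A. \<integral>y. y - s\<^sup>2 * v \<partial>?M A)"
    proof (rule integral_output_law_spike_law[OF adm(2,3)[OF s] M])
      fix A assume A: "A \<subseteq> ?I"
      interpret prob_space "?M A" by (rule randomized_algorithm_spike_data[OF M])
      show "integrable (?M A) (\<lambda>y. y - s\<^sup>2 * v)" using int1[OF A] by simp
    qed simp
    also have "\<dots> = random_subset_mean (s\<^sup>2) ?I (\<lambda>A. F A - s\<^sup>2 * v)"
      unfolding random_subset_mean_def
    proof (intro sum.cong refl arg_cong2[where f = "(*)"])
      fix A assume A: "A \<in> Pow ?I"
      interpret prob_space "?M A" by (rule randomized_algorithm_spike_data[OF M])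
      show "(\<integral>y. y - s\<^sup>2 * v \<partial>?M A) = F A - s\<^sup>2 * v"
        using int1 A by (simp add: F_def prob_space)
    qed
    also have "\<dots> = random_subset_mean (s\<^sup>2) ?I F - s\<^sup>2 * v"
      by (simp only: random_subset_mean_linear(2) random_subset_mean_const finite_lessThan)
    finally show ?thesis
      using accurate[OF adm(1)[OF s]] by (simp add: mean[OF s])
  qed
  have variance: "random_subset_mean (s\<^sup>2) ?I (\<lambda>A. \<integral>y. (y - s\<^sup>2 * v)\<^sup>2 \<partial>?M A) \<le> \<alpha>\<^sup>2"
    if s: "0 \<le> s" "s \<le> 1 / v" for s
  proof -
    let ?Out = "output_law n (spike_law v (s\<^sup>2)) M"
    note out = integral_output_law_spike_law[OF adm(2,3)[OF s] M int, of "s\<^sup>2 * v"]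
    have "ennreal (\<integral>y. (y - s\<^sup>2 * v)\<^sup>2 \<partial>?Out) = (\<integral>\<^sup>+y. ennreal ((y - s\<^sup>2 * v)\<^sup>2) \<partial>?Out)"
      using out(2) by (intro nn_integral_eq_integral[symmetric]) auto
    also have "\<dots> \<le> ennreal (\<alpha>\<^sup>2)"
      using accurate[OF adm(1)[OF s]] by (simp add: mean[OF s] mean_square_deviation_def)
    finally show ?thesis using out(1) by (simp add: ennreal_le_iff)
  qed
  define B where "B = real n * \<alpha> * (3 * (exp \<epsilon> - 1) / v + 8 * sqrt \<delta>)"
  have slope: "2 * s * D (s\<^sup>2) \<le> B" if s: "0 < s" "s < 1 / v" for s
  proof -
    have s': "0 \<le> s" "s \<le> 1 / v" "s \<le> 1/2" using s v by linarith+
    have "D (s\<^sup>2) \<le> (\<Sum>i\<in>?I. \<alpha> * (3/2 * (exp \<epsilon> - 1) + 4 * sqrt \<delta> / s))"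
      unfolding D_def F_def using v int variance[OF s'(1,2)]
      by (intro sum_mono expected_influence_le[OF dp pos(1-3) s(1) s'(3), where m = "s\<^sup>2 * v"]) auto
    then have "2 * s * D (s\<^sup>2) \<le> 2 * s * (real n * (\<alpha> * (3/2 * (exp \<epsilon> - 1) + 4 * sqrt \<delta> / s)))"
      using s by (intro mult_left_mono) auto
    also have "\<dots> = real n * \<alpha> * (3 * (exp \<epsilon> - 1) * s + 8 * sqrt \<delta>)"
      using s by (simp add: field_simps)
    also have "\<dots> \<le> real n * \<alpha> * (3 * (exp \<epsilon> - 1) * (1 / v) + 8 * sqrt \<delta>)"
      using pos s' by (intro mult_left_mono add_right_mono) auto
    finally show ?thesis by (simp add: B_def)
  qed
  have "\<exists>s>0. s < 1 / v \<and> random_subset_mean ((1 / v)\<^sup>2) ?I F - random_subset_mean (0\<^sup>2) ?I F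
      = (1 / v - 0) * (2 * s * D (s\<^sup>2))"
  proof (rule MVT2)
    show "0 < 1 / v" using v by simp
    fix s :: real
    have "((\<lambda>s. random_subset_mean (s\<^sup>2) ?I F) has_real_derivative D (s\<^sup>2) * (2 * s)) (at s)"
      unfolding D_def
      by (rule DERIV_chain2[OF has_derivative_random_subset_mean]) (auto intro!: derivative_eq_intros)
    then show "((\<lambda>s. random_subset_mean (s\<^sup>2) ?I F) has_real_derivative 2 * s * D (s\<^sup>2)) (at s)"
      by (simp add: mult.commute)
  qed
  then obtain s where s: "0 < s" "s < 1 / v"
    and rise: "random_subset_mean ((1 / v)\<^sup>2) ?I F - random_subset_mean (0\<^sup>2) ?I F = 1 / v * (2 * s * D (s\<^sup>2))"
    by auto
  have "(1 / v)\<^sup>2 * v = 1 / v" using v by (simp add: power2_eq_square)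
  moreover have "\<beta> \<le> 1 / v / 4" using bv v by (simp add: field_simps)
  ultimately have "1 / v * (1/2) \<le> 1 / v * (2 * s * D (s\<^sup>2))"
    using bias[of "1 / v"] bias[of 0] v unfolding rise[symmetric] by auto
  then have "1/2 \<le> 2 * s * D (s\<^sup>2)" by (rule mult_left_le_imp_le) (use v in simp)
  also have "\<dots> \<le> B" by (rule slope[OF s])
  finally show ?thesis unfolding B_def .
qed

text \<open>
  The condition \<open>v * sqrt \<delta> \<le> \<epsilon>\<close> makes the first term of the tradeoff dominate, and bounded \<open>\<epsilon>\<close>
  makes \<open>exp \<epsilon> - 1\<close> linear in \<open>\<epsilon>\<close>. The tradeoff needs a positive \<open>\<alpha>\<close>, so it is used for every
  \<open>a > \<alpha>\<close>, which also excludes \<open>\<alpha> = 0\<close>.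
\<close>

lemma accuracy_lower_bound:
  assumes dp: "differentially_private \<epsilon> \<delta> n borel borel M"
    and pos: "1 \<le> n" "0 < \<epsilon>" "0 < \<delta>" "0 \<le> \<alpha>" "2 \<le> v"
    and bv: "4 * \<beta> * v \<le> 1" and dv: "v * sqrt \<delta> \<le> \<epsilon>" and eps: "\<epsilon> \<le> 15"
    and accurate: "\<And>P. admissible P \<Longrightarrow>
          \<bar>\<integral>y. (y - mean P) \<partial>(output_law n P M)\<bar> \<le> \<beta> \<and>
          mean_square_deviation (output_law n P M) (mean P) \<le> ennreal (\<alpha>\<^sup>2)"
  shows "v / (22 * exp 15 * real n * \<epsilon>) \<le> \<alpha>"
proof (rule dense_ge)
  fix a assume "\<alpha> < a"
  then have a: "0 < a" "\<alpha>\<^sup>2 \<le> a\<^sup>2" using pos by (auto intro: power_mono)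
  have "1/2 \<le> real n * a * (3 * (exp \<epsilon> - 1) / v + 8 * sqrt \<delta>)"
  proof (rule accurate_private_tradeoff[OF dp])
    fix P assume "admissible P"
    from accurate[OF this] a show "\<bar>\<integral>y. (y - mean P) \<partial>(output_law n P M)\<bar> \<le> \<beta> \<and>
          mean_square_deviation (output_law n P M) (mean P) \<le> ennreal (a\<^sup>2)"
      by (auto intro: order_trans ennreal_leI)
  qed (use pos a bv in auto)
  also have "\<dots> \<le> real n * a * (11 * exp 15 * \<epsilon> / v)"
  proof (intro mult_left_mono)
    have "exp \<epsilon> * (1 - \<epsilon>) \<le> exp \<epsilon> * exp (- \<epsilon>)"
      using exp_ge_add_one_self[of "- \<epsilon>"] by (intro mult_left_mono) auto
    then have "exp \<epsilon> - 1 \<le> \<epsilon> * exp \<epsilon>" by (simp add: exp_minus algebra_simps)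
    also have "\<dots> \<le> \<epsilon> * exp 15" using eps pos by (intro mult_left_mono) auto
    finally have "3 * (exp \<epsilon> - 1) / v \<le> 3 * (\<epsilon> * exp 15) / v"
      using pos by (intro divide_right_mono) auto
    moreover have "sqrt \<delta> \<le> \<epsilon> / v" using dv pos by (simp add: field_simps)
    moreover have "1 * (\<epsilon> / v) \<le> exp 15 * (\<epsilon> / v)" using pos by (intro mult_right_mono) auto
    moreover have "11 * exp 15 * \<epsilon> / v = 3 * (\<epsilon> * exp 15) / v + 8 * (exp 15 * (\<epsilon> / v))"
      using pos by (simp add: field_simps)
    ultimately show "3 * (exp \<epsilon> - 1) / v + 8 * sqrt \<delta> \<le> 11 * exp 15 * \<epsilon> / v"
      by linarith
  qed (use a in auto)
  finally have "1/2 \<le> real n * a * (11 * exp 15 * \<epsilon> / v)" .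
  then have "v \<le> real n * a * (22 * exp 15 * \<epsilon>)" using pos by (simp add: field_simps)
  then show "v / (22 * exp 15 * real n * \<epsilon>) \<le> a"
    using pos by (subst pos_divide_le_eq) (auto simp: algebra_simps)
qed

theorem theorem1p2:
  shows "\<exists>c::real. c > 0 \<and>
    (\<forall>(n::nat) (\<epsilon>::real) (\<delta>::real) (M :: (nat \<Rightarrow> real) \<Rightarrow> real measure) (\<beta>::real) (\<alpha>::real).
       n \<ge> 1 \<longrightarrow>
       \<epsilon> > 0 \<longrightarrow> 0 < \<delta> \<longrightarrow> \<delta> \<le> \<epsilon>\<^sup>2 / 200 \<longrightarrow> \<epsilon>\<^sup>2 / 200 \<le> 1 \<longrightarrow>
       differentially_private \<epsilon> \<delta> n borel borel M \<longrightarrow>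
       \<beta> \<in> {0..1/100} \<longrightarrow> \<alpha> \<ge> 0 \<longrightarrow>
       (\<forall>P. admissible P \<longrightarrow>
          \<bar>\<integral>y. (y - mean P) \<partial>(output_law n P M)\<bar> \<le> \<beta> \<and>
          mean_square_deviation (output_law n P M) (mean P) \<le> ennreal (\<alpha>\<^sup>2)) \<longrightarrow>
       ereal (\<alpha>\<^sup>2) \<ge> ereal c *
         min (if \<beta> = 0 then \<infinity> else ereal (1 / ((real n)\<^sup>2 * \<epsilon>\<^sup>2 * \<beta>\<^sup>2)))
             (ereal (1 / ((real n)\<^sup>2 * \<epsilon> * sqrt \<delta>))))"
proof -
  define K :: real where "K = (22 * exp 15)\<^sup>2"
  have K: "0 < K" by (simp add: K_def)
  show ?thesis
  proof (intro exI[of _ "1 / (16 * K)"] conjI allI impI)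
    show "0 < 1 / (16 * K)" using K by simp
    fix n :: nat and \<epsilon> \<delta> :: real and M :: "(nat \<Rightarrow> real) \<Rightarrow> real measure" and \<beta> \<alpha> :: real
    assume n: "1 \<le> n" and \<epsilon>: "0 < \<epsilon>" and \<delta>: "0 < \<delta>" "\<delta> \<le> \<epsilon>\<^sup>2 / 200" and \<epsilon>2: "\<epsilon>\<^sup>2 / 200 \<le> 1"
      and dp: "differentially_private \<epsilon> \<delta> n borel borel M"
      and \<beta>: "\<beta> \<in> {0..1/100}" and \<alpha>: "0 \<le> \<alpha>"
      and acc: "\<forall>P. admissible P \<longrightarrow>
          \<bar>\<integral>y. (y - mean P) \<partial>(output_law n P M)\<bar> \<le> \<beta> \<and>
          mean_square_deviation (output_law n P M) (mean P) \<le> ennreal (\<alpha>\<^sup>2)"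
    define r where "r = sqrt \<delta>"
    have r: "0 < r" "r\<^sup>2 = \<delta>" using \<delta> by (auto simp: r_def)
    have eps: "\<epsilon> \<le> 15" by (rule power2_le_imp_le) (use \<epsilon>2 in auto)
    have "(2 * r)\<^sup>2 \<le> \<epsilon>\<^sup>2" using \<delta> r by (simp add: power_mult_distrib)
    then have r\<epsilon>: "2 * r \<le> \<epsilon>" by (rule power2_le_imp_le) (use \<epsilon> in simp)
    have bound: "v\<^sup>2 / (K * (real n)\<^sup>2 * \<epsilon>\<^sup>2) \<le> \<alpha>\<^sup>2"
      if "2 \<le> v" "4 * \<beta> * v \<le> 1" "v * r \<le> \<epsilon>" for v
    proof -
      have "v / (22 * exp 15 * real n * \<epsilon>) \<le> \<alpha>"
        using accuracy_lower_bound[OF dp n \<epsilon> \<delta>(1) \<alpha> that(1,2)] that(3) eps acc by (simp add: r_def)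
      then have "(v / (22 * exp 15 * real n * \<epsilon>))\<^sup>2 \<le> \<alpha>\<^sup>2"
        using that n \<epsilon> by (intro power_mono) auto
      then show ?thesis by (simp add: K_def power_divide power_mult_distrib)
    qed
    \<comment> \<open>The case distinction decides which of \<open>\<epsilon> / r\<close> and \<open>1 / (4 * \<beta>)\<close> is the smaller spike; \<open>\<beta> = 0\<close> falls under the first.\<close>
    show "ereal (1 / (16 * K)) *
         min (if \<beta> = 0 then \<infinity> else ereal (1 / ((real n)\<^sup>2 * \<epsilon>\<^sup>2 * \<beta>\<^sup>2)))
             (ereal (1 / ((real n)\<^sup>2 * \<epsilon> * sqrt \<delta>))) \<le> ereal (\<alpha>\<^sup>2)"
    proof (cases "4 * \<beta> * \<epsilon> \<le> r")
      case True
      have "(\<epsilon> / r)\<^sup>2 / (K * (real n)\<^sup>2 * \<epsilon>\<^sup>2) \<le> \<alpha>\<^sup>2"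
        by (rule bound) (use r r\<epsilon> True in \<open>auto simp: field_simps\<close>)
      also have "(\<epsilon> / r)\<^sup>2 / (K * (real n)\<^sup>2 * \<epsilon>\<^sup>2) = 1 / (K * (real n)\<^sup>2 * (r * r))"
        using \<epsilon> by (simp add: power2_eq_square)
      finally have "1 / (K * (real n)\<^sup>2 * (r * r)) \<le> \<alpha>\<^sup>2" .
      moreover have "1 / (16 * K) * (1 / ((real n)\<^sup>2 * \<epsilon> * r)) \<le> 1 / (K * (real n)\<^sup>2 * (r * r))"
      proof -
        have "K * (real n)\<^sup>2 * (r * r) \<le> K * (real n)\<^sup>2 * (16 * \<epsilon> * r)"
          using K r r\<epsilon> by (intro mult_left_mono mult_right_mono) auto
        then have "1 / (K * (real n)\<^sup>2 * (16 * \<epsilon> * r)) \<le> 1 / (K * (real n)\<^sup>2 * (r * r))"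
          using K r n by (intro divide_left_mono) auto
        then show ?thesis by (simp add: mult_ac)
      qed
      ultimately have le: "1 / (16 * K) * (1 / ((real n)\<^sup>2 * \<epsilon> * r)) \<le> \<alpha>\<^sup>2" by linarith
      have "ereal (1 / (16 * K)) *
         min (if \<beta> = 0 then \<infinity> else ereal (1 / ((real n)\<^sup>2 * \<epsilon>\<^sup>2 * \<beta>\<^sup>2)))
             (ereal (1 / ((real n)\<^sup>2 * \<epsilon> * sqrt \<delta>)))
        \<le> ereal (1 / (16 * K)) * ereal (1 / ((real n)\<^sup>2 * \<epsilon> * r))"
        using K unfolding r_def by (intro ereal_mult_left_mono) auto
      also have "\<dots> \<le> ereal (\<alpha>\<^sup>2)" using le by simp
      finally show ?thesis .
    next
      case False
      have \<beta>0: "0 < \<beta>"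
      proof (rule ccontr)
        assume "\<not> 0 < \<beta>"
        then have "\<beta> = 0" using \<beta> by auto
        then show False using False r by simp
      qed
      have "(1 / (4 * \<beta>))\<^sup>2 / (K * (real n)\<^sup>2 * \<epsilon>\<^sup>2) \<le> \<alpha>\<^sup>2"
        by (rule bound) (use False \<beta> \<beta>0 in \<open>auto simp: field_simps\<close>)
      then have le: "1 / (16 * K) * (1 / ((real n)\<^sup>2 * \<epsilon>\<^sup>2 * \<beta>\<^sup>2)) \<le> \<alpha>\<^sup>2"
        by (simp add: power_divide power_mult_distrib mult_ac)
      have "ereal (1 / (16 * K)) *
         min (if \<beta> = 0 then \<infinity> else ereal (1 / ((real n)\<^sup>2 * \<epsilon>\<^sup>2 * \<beta>\<^sup>2)))
             (ereal (1 / ((real n)\<^sup>2 * \<epsilon> * sqrt \<delta>)))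
        \<le> ereal (1 / (16 * K)) * ereal (1 / ((real n)\<^sup>2 * \<epsilon>\<^sup>2 * \<beta>\<^sup>2))"
        using K \<beta>0 by (intro ereal_mult_left_mono) auto
      also have "\<dots> \<le> ereal (\<alpha>\<^sup>2)" using le by simp
      finally show ?thesis .
    qed
  qed
qed

end
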